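(* Let $(Q,\cdot,/)$ be a right division right cancelation groupoid which satisfies the cyclic associative law $x\cdot(y\cdot z)=(z\cdot x)\cdot y$ for all $x,y,z\in Q$. Then $(Q,\cdot)$ is a commutative group, and it satisfies each of the following identities for all $x,y,z\in Q$: $x\cdot(y\cdot z)=(x\cdot y)\cdot z$; $x\cdot(y\cdot z)=z\cdot(y\cdot x)$; $x\cdot(y\cdot z)=y\cdot(x\cdot z)$; $x\cdot(y\cdot z)=(z\cdot x)\cdot y$.
   Context: A groupoid $(Q,\cdot)$ is a non-empty set $Q$ with a binary operation $\cdot$. For $a\in Q$ let $R_a:Q\to Q$, $R_a x=x\cdot a$. The groupoid is a right division groupoid if $R_a$ is surjective for every $a\in Q$, and a right cancelation groupoid if $R_a$ is injective for every $a\in Q$. Writing a right division right cancelation groupoid as $(Q,\cdot,/)$ means that $/$ is the binary operation on $Q$ satisfying $(y/x)\cdot x=y$ and $(y\cdot x)/x=y$ for all $x,y\in Q$. *)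

theory Defs
  imports "HOL-Algebra.Group"
begin

text \<open>The operations are total functions on the ambient type; only their values on \<open>Q\<close> matter.\<close>

locale groupoid =
  fixes Q :: "'a set" and mul :: "'a \<Rightarrow> 'a \<Rightarrow> 'a" (infixl "\<cdot>" 70)
  assumes nonempty: "Q \<noteq> {}"
    and mul_closed: "\<lbrakk>x \<in> Q; y \<in> Q\<rbrakk> \<Longrightarrow> x \<cdot> y \<in> Q"
begin

definition right_translation :: "'a \<Rightarrow> 'a \<Rightarrow> 'a"
  where "right_translation a x = x \<cdot> a"

end

locale right_division_groupoid = groupoid +
  assumes right_translation_surj: "a \<in> Q \<Longrightarrow> right_translation a ` Q = Q"

locale right_cancelation_groupoid = groupoid +
  assumes right_translation_inj: "a \<in> Q \<Longrightarrow> inj_on (right_translation a) Q"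

locale right_division_right_cancelation_groupoid =
  right_division_groupoid Q mul + right_cancelation_groupoid Q mul
  for Q :: "'a set" and mul :: "'a \<Rightarrow> 'a \<Rightarrow> 'a" (infixl "\<cdot>" 70) +
  fixes rdiv :: "'a \<Rightarrow> 'a \<Rightarrow> 'a" (infixl "\<oslash>" 70)
  assumes rdiv_closed: "\<lbrakk>x \<in> Q; y \<in> Q\<rbrakk> \<Longrightarrow> x \<oslash> y \<in> Q"
    and rdiv_mul: "\<lbrakk>x \<in> Q; y \<in> Q\<rbrakk> \<Longrightarrow> (y \<oslash> x) \<cdot> x = y"
    and mul_rdiv: "\<lbrakk>x \<in> Q; y \<in> Q\<rbrakk> \<Longrightarrow> (y \<cdot> x) \<oslash> x = y"

end

theory Submission
  imports Defs
begin

text \<open>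
  Applying the cyclic law twice to \<open>((a \<cdot> b) \<cdot> c) \<cdot> d\<close> in two different orders gives
  \<open>(c \<cdot> a) \<cdot> (d \<cdot> b) = (a \<cdot> c) \<cdot> (b \<cdot> d)\<close>. For \<open>d = b\<close>, cancelling \<open>b \<cdot> b\<close> on the right yields
  commutativity, and with it the cyclic law becomes associativity.
\<close>

theorem theorem2:
  fixes Q :: "'a set"
    and mul :: "'a \<Rightarrow> 'a \<Rightarrow> 'a" (infixl "\<cdot>" 70)
    and rdiv :: "'a \<Rightarrow> 'a \<Rightarrow> 'a"
  assumes "right_division_right_cancelation_groupoid Q mul rdiv"
    and "\<forall>x\<in>Q. \<forall>y\<in>Q. \<forall>z\<in>Q. x \<cdot> (y \<cdot> z) = (z \<cdot> x) \<cdot> y"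
  shows "(\<exists>e. comm_group \<lparr>carrier = Q, mult = mul, one = e\<rparr>)
    \<and> (\<forall>x\<in>Q. \<forall>y\<in>Q. \<forall>z\<in>Q. x \<cdot> (y \<cdot> z) = (x \<cdot> y) \<cdot> z)
    \<and> (\<forall>x\<in>Q. \<forall>y\<in>Q. \<forall>z\<in>Q. x \<cdot> (y \<cdot> z) = z \<cdot> (y \<cdot> x))
    \<and> (\<forall>x\<in>Q. \<forall>y\<in>Q. \<forall>z\<in>Q. x \<cdot> (y \<cdot> z) = y \<cdot> (x \<cdot> z))
    \<and> (\<forall>x\<in>Q. \<forall>y\<in>Q. \<forall>z\<in>Q. x \<cdot> (y \<cdot> z) = (z \<cdot> x) \<cdot> y)"
proof -
  interpret right_division_right_cancelation_groupoid Q mul rdiv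
    by (rule assms(1))
  have cyc: "x \<cdot> (y \<cdot> z) = (z \<cdot> x) \<cdot> y" if "x \<in> Q" "y \<in> Q" "z \<in> Q" for x y z
    using assms(2) that by blast
  have comm: "a \<cdot> c = c \<cdot> a" if a: "a \<in> Q" and c: "c \<in> Q" for a c
  proof -
    have swap: "(c \<cdot> a) \<cdot> (d \<cdot> b) = (a \<cdot> c) \<cdot> (b \<cdot> d)" if b: "b \<in> Q" and d: "d \<in> Q" for b d
    proof -
      have "(c \<cdot> a) \<cdot> (d \<cdot> b) = (b \<cdot> (c \<cdot> a)) \<cdot> d"
        using a b c d by (intro cyc mul_closed)
      also have "\<dots> = ((a \<cdot> b) \<cdot> c) \<cdot> d"
        using a b c cyc[of b c a] by simp
      also have "\<dots> = c \<cdot> (d \<cdot> (a \<cdot> b))"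
        using a b c d by (intro cyc[symmetric] mul_closed)
      also have "\<dots> = c \<cdot> ((b \<cdot> d) \<cdot> a)"
        using a b d cyc[of d a b] by simp
      also have "\<dots> = (a \<cdot> c) \<cdot> (b \<cdot> d)"
        using a b c d by (intro cyc mul_closed)
      finally show ?thesis .
    qed
    show ?thesis
      \<comment> \<open>With \<open>b\<close> and \<open>d\<close> both taken to be
        \<open>a\<close>, each side has the right factor \<open>a \<cdot> a\<close>, which right
        division by it removes.\<close>
      using swap[OF a a] mul_rdiv[of "a \<cdot> a"] a c by (metis mul_closed)
  qed
  \<comment> \<open>Two uses of the cyclic law joined by commutativity: \<open>x \<cdot> (y \<cdot>
    z) = (z \<cdot> x) \<cdot> y = y \<cdot> (z \<cdot> x) = (x \<cdot> y) \<cdot>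
    z\<close>.\<close>
  have assoc: "x \<cdot> (y \<cdot> z) = (x \<cdot> y) \<cdot> z" if "x \<in> Q" "y \<in> Q" "z \<in> Q" for x y z
    using that by (metis comm cyc mul_closed)
  obtain a where a: "a \<in> Q"
    using nonempty by blast
  \<comment> \<open>The solution of \<open>e \<cdot> a = a\<close>: at first a left unit for the
    single element \<open>a\<close> only.\<close>
  define e where "e = rdiv a a"
  have e: "e \<in> Q" "e \<cdot> a = a"
    using a by (simp_all add: e_def rdiv_closed rdiv_mul)
  have left_one: "e \<cdot> b = b" if b: "b \<in> Q" for b
  proof -
    \<comment> \<open>Every \<open>b\<close> has \<open>a\<close> as a left factor, so the unit law
      spreads from \<open>a\<close>: \<open>e \<cdot> b = (e \<cdot> a) \<cdot> rdiv b a = a \<cdot>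
      rdiv b a = b\<close>.\<close>
    have "b = a \<cdot> rdiv b a"
      using a b by (metis comm rdiv_closed rdiv_mul)
    then show ?thesis
      using a b e by (metis assoc rdiv_closed)
  qed
  have "comm_group \<lparr>carrier = Q, mult = mul, one = e\<rparr>"
  proof (rule comm_groupI; simp only: monoid.simps partial_object.simps)
    \<comment> \<open>The left inverse of \<open>x\<close> is \<open>rdiv e x\<close>.\<close>
    show "\<exists>y\<in>Q. y \<cdot> x = e" if "x \<in> Q" for x
      using that e(1) rdiv_closed rdiv_mul by blast
  qed (fact mul_closed e(1) assoc[symmetric] comm left_one)+
  moreover have "x \<cdot> (y \<cdot> z) = z \<cdot> (y \<cdot> x)" "x \<cdot> (y \<cdot> z) = y \<cdot> (x \<cdot> z)"
    if "x \<in> Q" "y \<in> Q" "z \<in> Q" for x y z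
    using that by (metis assoc comm mul_closed)+
  ultimately show ?thesis
    using assoc cyc by blast
qed

end
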